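(* Let $n\ge 2$ and let $F=F(s,p,N)\in C^1(\mathbb R\times\mathbb R^n\times\mathcal S^{n\times n})$ satisfy $$\sum_{i,j}\frac{\partial F}{\partial N_{ij}}(s,p,N)\,\xi_i\xi_j>0\qquad\forall\,\xi\in\mathbb R^n\setminus\{0\},\ \forall\,(s,p,N).$$ Let $\Omega=\{(t,y) : y\in\mathbb R^{n-1},\ |y|<1,\ 0<t<1\}$ and let $u,v\in C^2(\Omega)$ satisfy: (a) whenever $(t,y),(s,y)\in\Omega$ and $u(t,y)=v(s,y)$, then $F(u,\nabla u,\nabla^2u)(t,y)\le F(v,\nabla v,\nabla^2v)(s,y)$; (b) $u\ge v$ in $\Omega$; (c) $\max\{u_t,v_t\}>0$ in $\Omega$. Then either $u>v$ in $\Omega$, or $u\equiv v$ in $\Omega$.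
   Context: $\mathcal S^{n\times n}$ denotes the set of real symmetric $n\times n$ matrices. Gradient and Hessian are taken in the variables $(t,y)\in\mathbb R^n$. *)

theory Defs
  imports "HOL-Analysis.Analysis"
begin

text \<open>
  Points of \<open>\<real>\<^sup>n\<close> have type \<^typ>\<open>real^'n\<close> with \<open>n = CARD('n)\<close>. A distinguished index \<open>k\<close>
  marks the coordinate \<open>t\<close>; the remaining \<open>n - 1\<close> coordinates form \<open>y\<close>.
\<close>

definition cylinder :: "'n::finite \<Rightarrow> (real^'n) set" where
  "cylinder k = {x. L2_set (\<lambda>i. x $ i) (UNIV - {k}) < 1 \<and> 0 < x $ k \<and> x $ k < 1}"

definition same_y :: "'n::finite \<Rightarrow> real^'n \<Rightarrow> real^'n \<Rightarrow> bool" where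
  "same_y k x x' \<longleftrightarrow> (\<forall>i. i \<noteq> k \<longrightarrow> x $ i = x' $ i)"

definition sym_matrices :: "(real^'n^'n) set" where
  "sym_matrices = {A. transpose A = A}"

text \<open>
  Continuous differentiability relative to \<open>S\<close>, used both for an open set \<open>S\<close>, where it is the
  ordinary notion, and for a linear subspace \<open>S\<close>, where differentiation takes place inside the
  subspace. In the latter case the derivative is determined only on \<open>S\<close>, hence the existential.
\<close>

definition C1_on :: "'a::real_normed_vector set \<Rightarrow> ('a \<Rightarrow> real) \<Rightarrow> bool" where
  "C1_on S f \<longleftrightarrow>
     (\<exists>f' :: 'a \<Rightarrow> 'a \<Rightarrow>\<^sub>L real.
        (\<forall>x\<in>S. (f has_derivative blinfun_apply (f' x)) (at x within S)) \<and> continuous_on S f')"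

definition partial_deriv :: "'n::finite \<Rightarrow> (real^'n \<Rightarrow> real) \<Rightarrow> real^'n \<Rightarrow> real" where
  "partial_deriv i f x = deriv (\<lambda>h. f (x + h *\<^sub>R axis i 1)) 0"

definition gradient :: "(real^'n::finite \<Rightarrow> real) \<Rightarrow> real^'n \<Rightarrow> real^'n" where
  "gradient f x = (\<chi> i. partial_deriv i f x)"

definition hessian :: "(real^'n::finite \<Rightarrow> real) \<Rightarrow> real^'n \<Rightarrow> real^'n^'n" where
  "hessian f x = (\<chi> i j. partial_deriv i (partial_deriv j f) x)"

definition C2_on :: "(real^'n::finite) set \<Rightarrow> (real^'n \<Rightarrow> real) \<Rightarrow> bool" where
  "C2_on S f \<longleftrightarrow> C1_on S f \<and> (\<forall>i. C1_on S (partial_deriv i f))"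

text \<open>
  The entries \<open>N\<^sub>i\<^sub>j\<close> and \<open>N\<^sub>j\<^sub>i\<close> of a symmetric matrix cannot vary independently. As usual,
  \<open>\<partial>F/\<partial>N\<^sub>i\<^sub>j\<close> is the partial derivative of the extension \<open>M \<mapsto> F (s, p, (M + M\<^sup>T) / 2)\<close> to all
  matrices, i.e. the derivative of \<open>F\<close> along the symmetrized matrix unit below. With this
  convention the sum of \<open>\<partial>F/\<partial>N\<^sub>i\<^sub>j H\<^sub>i\<^sub>j\<close> over all \<open>i\<close> and \<open>j\<close> is the derivative of \<open>F\<close> in the
  symmetric direction \<open>H\<close>.
\<close>

definition sym_unit :: "'n \<Rightarrow> 'n \<Rightarrow> real^'n^'n::finite" where
  "sym_unit i j =
     (\<chi> a b. ((if a = i \<and> b = j then 1 else 0) + (if a = j \<and> b = i then 1 else 0)) / 2)"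

definition partial_N ::
  "(real \<times> (real^'n) \<times> (real^'n^'n) \<Rightarrow> real) \<Rightarrow> 'n::finite \<Rightarrow> 'n \<Rightarrow> real \<times> (real^'n) \<times> (real^'n^'n) \<Rightarrow> real"
  where
  "partial_N F i j = (\<lambda>(s, p, N). deriv (\<lambda>h. F (s, p, N + h *\<^sub>R sym_unit i j)) 0)"

end

theory Submission imports Defs begin

text \<open>
  A strong maximum principle for a comparison that is shifted along one axis. Write \<open>e\<close> for the
  \<open>k\<close>-th unit vector. Suppose \<open>u\<close> and \<open>v\<close> agree somewhere but not everywhere. As in the classical
  proof, there is a closed ball in the domain in which \<open>u = v\<close> holds exactly at one
  boundary point \<open>x0\<close> (\<open>obtain_touching_ball\<close>). There the gradients agree, so the derivative of
  \<open>v\<close> along \<open>e\<close> is positive at and near \<open>x0\<close>.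

  The comparison hypothesis relates \<open>u\<close> at a point to \<open>v\<close> at a point displaced along \<open>e\<close>. If \<open>\<phi>\<close> is
  defined near \<open>x0\<close> by \<open>u x = v (x + \<phi> x *\<^sub>R e)\<close>, then \<open>\<phi> \<ge> 0\<close>, and linearization turns the
  comparison hypothesis into an elliptic differential inequality for \<open>\<phi>\<close>. It has no zeroth order
  term: when \<open>\<phi>\<close> is constant, the jet of \<open>u\<close> is that of \<open>v\<close> at the displaced point. The Hopf
  barrier then yields a contradiction.

  The function \<open>\<phi>\<close> itself can be avoided. A barrier touching \<open>\<phi>\<close> from below at a point corresponds to
  a displaced function \<open>V x = v (x + (h x + m) *\<^sub>R e)\<close>, with \<open>h\<close> the barrier and \<open>m\<close> a constant, touching
  \<open>u\<close> from below. A compactness argument produces such a contact (\<open>no_first_contact\<close>). At the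
  contact point the gradients of \<open>u\<close> and \<open>V\<close> agree and the Hessian of \<open>u\<close> dominates that of \<open>V\<close>
  (\<open>touching_from_below\<close>), so by monotonicity (\<open>mono_in_matrix\<close>) the operator is at least as large on
  the jet of \<open>u\<close> as on that of \<open>V\<close>. The latter is strictly larger than on the jet of \<open>v\<close> at the
  displaced point (\<open>bending_increases\<close>), against the comparison hypothesis.
\<close>

section \<open>Compactness and one-variable calculus\<close>

lemma compact_nonpos_part:
  fixes g :: "'a::metric_space \<Rightarrow> real"
  assumes "compact K" "continuous_on K g"
  shows "compact {z \<in> K. g z \<le> 0}"
proof -
  have "closed {z \<in> K. g z \<le> 0}"
    using continuous_closed_preimage[OF assms(2) compact_imp_closed[OF assms(1)], of "{..0}"]
    by (simp add: vimage_def Int_def)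
  then have "compact (K \<inter> {z \<in> K. g z \<le> 0})"
    using assms(1) by (rule compact_Int_closed[rotated])
  moreover have "K \<inter> {z \<in> K. g z \<le> 0} = {z \<in> K. g z \<le> 0}" by blast
  ultimately show ?thesis by simp
qed

text \<open>
  The parameters at which \<open>g\<close> fails to be positive form the projection of a compact set, and
  this projection misses \<open>0\<close>; half its minimum is a uniform bound.
\<close>

lemma compact_uniform_pos:
  fixes g :: "real \<times> 'a::metric_space \<Rightarrow> real"
  assumes "compact K" and cont: "continuous_on ({0..1} \<times> K) g"
    and pos: "\<And>x. x \<in> K \<Longrightarrow> 0 < g (0, x)"
  obtains t0 where "0 < t0" "t0 \<le> 1" "\<And>t x. 0 \<le> t \<Longrightarrow> t \<le> t0 \<Longrightarrow> x \<in> K \<Longrightarrow> 0 < g (t, x)"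
proof -
  define T where "T = {z \<in> {0..1} \<times> K. g z \<le> 0}"
  have KK: "compact ({0..1::real} \<times> K)"
    using assms(1) by (intro compact_Times) auto
  have "compact T" unfolding T_def by (rule compact_nonpos_part[OF KK cont])
  then have cT: "compact (fst ` T)"
    by (intro compact_continuous_image continuous_intros)
  show thesis
  proof (cases "T = {}")
    case True
    then show thesis using that[of 1] by (force simp: T_def not_le)
  next
    case False
    then obtain s where s: "s \<in> fst ` T" "\<And>t. t \<in> fst ` T \<Longrightarrow> s \<le> t"
      using compact_attains_inf[OF cT] by auto
    have "0 \<le> s" "s \<le> 1" using s(1) by (auto simp: T_def)
    moreover have "s \<noteq> 0" using s(1) pos by (force simp: T_def)
    ultimately have "0 < s" by simp
    show thesis
    proof (rule that[of "s / 2"])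
      fix t x assume t: "0 \<le> t" "t \<le> s / 2" "x \<in> K"
      then have "t \<notin> fst ` T" using s(2)[of t] \<open>0 < s\<close> by auto
      then have "(t, x) \<notin> T" by force
      then show "0 < g (t, x)"
        using t \<open>s \<le> 1\<close> by (simp add: T_def)
    qed (use \<open>0 < s\<close> \<open>s \<le> 1\<close> in auto)
  qed
qed

lemma second_derivative_nonneg_at_min:
  fixes \<phi> :: "real \<Rightarrow> real"
  assumes r: "0 < r"
    and d1: "\<And>t. \<bar>t\<bar> < r \<Longrightarrow> (\<phi> has_real_derivative \<phi>' t) (at t)"
    and d2: "(\<phi>' has_real_derivative d) (at 0)"
    and min: "\<And>t. \<bar>t\<bar> < r \<Longrightarrow> \<phi> 0 \<le> \<phi> t"
  shows "\<phi>' 0 = 0" and "0 \<le> d"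
proof -
  show z: "\<phi>' 0 = 0"
    using DERIV_local_min[OF d1[of 0] r] min r by simp
  show "0 \<le> d"
  proof (rule ccontr)
    assume "\<not> 0 \<le> d"
    then obtain e where e: "e > 0" "\<And>h. 0 < h \<Longrightarrow> h < e \<Longrightarrow> \<phi>' h < 0"
      using DERIV_neg_dec_right[OF d2] z by (auto simp: not_le)
    define h where "h = min e r / 2"
    have h: "0 < h" "h < e" "h < r" using e r by (auto simp: h_def)
    have "\<phi> 0 > \<phi> h"
    proof (rule DERIV_neg_imp_decreasing_open[OF h(1)])
      fix t assume "0 < t" "t < h"
      then show "\<exists>y. (\<phi> has_real_derivative y) (at t) \<and> y < 0"
        using d1[of t] e(2)[of t] h by auto
    next
      show "continuous_on {0..h} \<phi>"
        using h by (intro continuous_at_imp_continuous_on ballI DERIV_isCont[OF d1]) auto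
    qed
    then show False using min[of h] h by auto
  qed
qed

section \<open>Gradients and Hessians\<close>

lemma mem_sym_matrices_iff: "A \<in> sym_matrices \<longleftrightarrow> (\<forall>i j. A $ i $ j = A $ j $ i)"
  by (auto simp: sym_matrices_def transpose_def vec_eq_iff)

lemma partial_deriv_eq:
  assumes "(f has_derivative f') (at x)"
  shows "partial_deriv i f x = f' (axis i 1)"
proof -
  interpret bounded_linear f' using assms by (rule has_derivative_bounded_linear)
  have "((\<lambda>h. x + h *\<^sub>R axis i 1) has_derivative (\<lambda>h. h *\<^sub>R axis i 1)) (at 0)"
    by (auto intro!: derivative_eq_intros)
  from has_derivative_compose[OF this, of f f'] assms
  have "((\<lambda>h. f (x + h *\<^sub>R axis i 1)) has_derivative (\<lambda>h. f' (h *\<^sub>R axis i 1))) (at 0)"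
    by simp
  then have "((\<lambda>h. f (x + h *\<^sub>R axis i 1)) has_real_derivative f' (axis i 1)) (at 0)"
    by (simp add: has_field_derivative_def scaleR mult.commute mult_commute_abs)
  then show ?thesis
    unfolding partial_deriv_def by (rule DERIV_imp_deriv)
qed

text \<open>
  On an open set the total derivative supplied by \<^const>\<open>C1_on\<close> is represented by the vector of
  partial derivatives, so its continuity is inherited by the gradient.
\<close>

lemma C1_on_open:
  fixes f :: "real^'n::finite \<Rightarrow> real"
  assumes "open S" "C1_on S f"
  shows "x \<in> S \<Longrightarrow> (f has_derivative (\<lambda>h. gradient f x \<bullet> h)) (at x)"
    and "continuous_on S (partial_deriv i f)"
    and "continuous_on S (gradient f)"
    and "continuous_on S f"
proof -
  obtain f' :: "real^'n \<Rightarrow> (real^'n) \<Rightarrow>\<^sub>L real"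
    where f': "\<And>x. x \<in> S \<Longrightarrow> (f has_derivative f' x) (at x)" "continuous_on S f'"
    using assms unfolding C1_on_def by (metis at_within_open)
  have p: "partial_deriv i f x = f' x (axis i 1)" if "x \<in> S" for x i
    using partial_deriv_eq[OF f'(1)[OF that]] .
  have g: "blinfun_apply (f' x) = (\<lambda>h. gradient f x \<bullet> h)" if "x \<in> S" for x
  proof
    fix h
    have "f' x h = f' x (\<Sum>i\<in>UNIV. h $ i *\<^sub>R axis i 1)"
      by (simp add: basis_expansion flip: scalar_mult_eq_scaleR)
    also have "\<dots> = gradient f x \<bullet> h"
      by (simp add: blinfun.sum_right blinfun.scaleR_right gradient_def inner_vec_def p[OF that] mult.commute)
    finally show "f' x h = gradient f x \<bullet> h" .
  qed
  show "x \<in> S \<Longrightarrow> (f has_derivative (\<lambda>h. gradient f x \<bullet> h)) (at x)"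
    using f'(1) g by metis
  show c: "continuous_on S (partial_deriv i f)" for i
  proof -
    have "continuous_on S (\<lambda>x. f' x (axis i 1))"
      by (intro continuous_intros f'(2))
    then show ?thesis using p by (simp cong: continuous_on_cong)
  qed
  show "continuous_on S (gradient f)"
    unfolding gradient_def by (intro continuous_on_vec_lambda c)
  show "continuous_on S f"
    using f'(1) by (intro continuous_at_imp_continuous_on ballI has_derivative_continuous) blast
qed

lemma has_real_derivative_along_curve:
  fixes f :: "real^'n::finite \<Rightarrow> real"
  assumes "open S" "C1_on S f" "\<gamma> t \<in> S" "(\<gamma> has_vector_derivative \<gamma>') (at t)"
  shows "((\<lambda>t. f (\<gamma> t)) has_real_derivative gradient f (\<gamma> t) \<bullet> \<gamma>') (at t)"
  using has_derivative_compose[OF assms(4)[unfolded has_vector_derivative_def] C1_on_open(1)[OF assms(1-3)]]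
  by (simp add: has_field_derivative_def mult_commute_abs)

text \<open>
  Two applications of the mean value theorem, first along the \<open>i\<close>-th and then along the
  \<open>j\<close>-th axis. The left-hand side is symmetric in \<open>i\<close> and \<open>j\<close> while the right-hand side is
  not; this is what forces the two mixed derivatives to agree in the limit.
\<close>

lemma second_difference_eq_mixed_partial:
  fixes f :: "real^'n::finite \<Rightarrow> real"
  assumes S: "open S" and f: "C2_on S f" and h: "0 < h" and sub: "cball x (2 * h) \<subseteq> S"
  obtains z where "z \<in> cball x (2 * h)"
    "f (x + h *\<^sub>R axis i 1 + h *\<^sub>R axis j 1) - f (x + h *\<^sub>R axis i 1) - f (x + h *\<^sub>R axis j 1) + f x
      = h\<^sup>2 * hessian f z $ j $ i"
proof -
  let ?p = "\<lambda>s t. x + s *\<^sub>R axis i 1 + t *\<^sub>R axis j (1::real)"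
  have box: "?p s t \<in> cball x (2 * h)" if "0 \<le> s" "s \<le> h" "0 \<le> t" "t \<le> h" for s t
  proof -
    have "norm (s *\<^sub>R axis i (1::real) + t *\<^sub>R axis j 1) \<le> \<bar>s\<bar> * 1 + \<bar>t\<bar> * 1"
      by (rule order_trans[OF norm_triangle_ineq]) simp
    then show ?thesis using that by (simp add: dist_norm algebra_simps norm_minus_commute)
  qed
  have C1: "C1_on S f" "\<And>i. C1_on S (partial_deriv i f)"
    using f by (auto simp: C2_on_def)
  have di: "((\<lambda>s. f (?p s t)) has_real_derivative partial_deriv i f (?p s t)) (at s)"
    if "0 \<le> s" "s \<le> h" "0 \<le> t" "t \<le> h" for s t
  proof -
    have "((\<lambda>s. ?p s t) has_vector_derivative axis i 1) (at s)"
      by (auto intro!: derivative_eq_intros)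
    from has_real_derivative_along_curve[OF S C1(1) _ this] box[OF that] sub
    show ?thesis by (simp add: subset_iff gradient_def inner_axis)
  qed
  have dj: "((\<lambda>t. partial_deriv i f (?p s t)) has_real_derivative hessian f (?p s t) $ j $ i) (at t)"
    if "0 \<le> s" "s \<le> h" "0 \<le> t" "t \<le> h" for s t
  proof -
    have "((\<lambda>t. ?p s t) has_vector_derivative axis j 1) (at t)"
      by (auto intro!: derivative_eq_intros)
    from has_real_derivative_along_curve[OF S C1(2) _ this] box[OF that] sub
    show ?thesis by (simp add: subset_iff gradient_def hessian_def inner_axis)
  qed
  have "\<exists>s. 0 < s \<and> s < h \<and> (f (?p h h) - f (?p h 0)) - (f (?p 0 h) - f (?p 0 0))
      = (h - 0) * (partial_deriv i f (?p s h) - partial_deriv i f (?p s 0))"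
    using h by (intro MVT2 DERIV_diff di) auto
  then obtain s where s: "0 < s" "s < h"
    "(f (?p h h) - f (?p h 0)) - (f (?p 0 h) - f (?p 0 0))
      = (h - 0) * (partial_deriv i f (?p s h) - partial_deriv i f (?p s 0))" by blast
  have "\<exists>t. 0 < t \<and> t < h \<and>
      partial_deriv i f (?p s h) - partial_deriv i f (?p s 0) = (h - 0) * hessian f (?p s t) $ j $ i"
    using h s by (intro MVT2 dj) auto
  then obtain t where t: "0 < t" "t < h"
    "partial_deriv i f (?p s h) - partial_deriv i f (?p s 0) = (h - 0) * hessian f (?p s t) $ j $ i"
    by blast
  show thesis
    using that[OF box[of s t]] s t by (simp add: power2_eq_square)
qed

lemma C2_on_continuous_hessian:
  fixes f :: "real^'n::finite \<Rightarrow> real"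
  assumes "open S" "C2_on S f"
  shows "continuous_on S (hessian f)"
proof -
  have "continuous_on S (\<lambda>x. partial_deriv i (partial_deriv j f) x)" for i j
    using assms by (auto simp: C2_on_def intro: C1_on_open(2))
  then show ?thesis unfolding hessian_def by (intro continuous_on_vec_lambda)
qed

text \<open>
  The second difference quotient is symmetric in the two directions and converges to both mixed
  derivatives (Schwarz's theorem). Without this the Hessian would not be an admissible argument
  of an operator on symmetric matrices.
\<close>

lemma hessian_symmetric:
  fixes f :: "real^'n::finite \<Rightarrow> real"
  assumes S: "open S" and f: "C2_on S f" and x: "x \<in> S"
  shows "hessian f x \<in> sym_matrices"
  unfolding mem_sym_matrices_iff
proof (intro allI)
  fix i j
  let ?H = "hessian f"
  have "norm (?H x $ i $ j - ?H x $ j $ i) < e + e" if "0 < e" for e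
  proof -
    have "\<exists>d>0. \<forall>z\<in>S. dist z x < d \<longrightarrow> dist (?H z $ a $ b) (?H x $ a $ b) < e" for a b
    proof -
      have "continuous_on S (\<lambda>z. ?H z $ a $ b)"
        by (intro continuous_intros C2_on_continuous_hessian S f)
      then show ?thesis using x \<open>0 < e\<close> unfolding continuous_on_iff by blast
    qed
    then obtain d1 d2 where d: "d1 > 0" "\<And>z. z \<in> S \<Longrightarrow> dist z x < d1 \<Longrightarrow> dist (?H z $ i $ j) (?H x $ i $ j) < e"
      "d2 > 0" "\<And>z. z \<in> S \<Longrightarrow> dist z x < d2 \<Longrightarrow> dist (?H z $ j $ i) (?H x $ j $ i) < e"
      by metis
    obtain r where r: "r > 0" "cball x r \<subseteq> S" using S x open_contains_cball by blast
    define h where "h = min r (min d1 d2) / 4"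
    have h: "0 < h" "2 * h < d1" "2 * h < d2" "2 * h \<le> r" using r d by (auto simp: h_def)
    then have sub: "cball x (2 * h) \<subseteq> S" using r by force
    obtain z where z: "z \<in> cball x (2 * h)"
      "f (x + h *\<^sub>R axis i 1 + h *\<^sub>R axis j 1) - f (x + h *\<^sub>R axis i 1) - f (x + h *\<^sub>R axis j 1) + f x
        = h\<^sup>2 * ?H z $ j $ i"
      using second_difference_eq_mixed_partial[OF S f h(1) sub] .
    obtain w where w: "w \<in> cball x (2 * h)"
      "f (x + h *\<^sub>R axis j 1 + h *\<^sub>R axis i 1) - f (x + h *\<^sub>R axis j 1) - f (x + h *\<^sub>R axis i 1) + f x
        = h\<^sup>2 * ?H w $ i $ j"
      using second_difference_eq_mixed_partial[OF S f h(1) sub] .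
    have "h\<^sup>2 * ?H z $ j $ i = h\<^sup>2 * ?H w $ i $ j"
      using z(2) w(2) by (simp add: algebra_simps)
    then have "?H z $ j $ i = ?H w $ i $ j" using h by simp
    moreover have "dist (?H z $ j $ i) (?H x $ j $ i) < e"
      using d(4)[of z] z(1) subsetD[OF sub z(1)] h by (simp add: dist_commute)
    moreover have "dist (?H w $ i $ j) (?H x $ i $ j) < e"
      using d(2)[of w] w(1) subsetD[OF sub w(1)] h by (simp add: dist_commute)
    ultimately show ?thesis by (simp add: dist_norm)
  qed
  from this[of "\<bar>?H x $ i $ j - ?H x $ j $ i\<bar> / 2"]
  show "?H x $ i $ j = ?H x $ j $ i" by fastforce
qed

text \<open>
  The first index of \<^const>\<open>hessian\<close> is that of the outer derivative, so the Jacobian of the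
  gradient is the transpose of the Hessian; by symmetry it is the Hessian itself.
\<close>

lemma gradient_has_derivative:
  fixes f :: "real^'n::finite \<Rightarrow> real"
  assumes S: "open S" and f: "C2_on S f" and x: "x \<in> S"
  shows "(gradient f has_derivative (\<lambda>h. hessian f x *v h)) (at x)"
proof -
  have sym: "hessian f x $ i $ j = hessian f x $ j $ i" for i j
    using hessian_symmetric[OF assms] by (simp add: mem_sym_matrices_iff)
  have "((\<lambda>y. partial_deriv i f y) has_derivative (\<lambda>h. (hessian f x *v h) $ i)) (at x)" for i
  proof -
    have "gradient (partial_deriv i f) x \<bullet> h = (hessian f x *v h) $ i" for h
      using sym[of i] by (simp add: matrix_vector_mult_def inner_vec_def gradient_def hessian_def)
    then show ?thesis
      using C1_on_open(1)[OF S, of "partial_deriv i f" x] f x by (simp add: C2_on_def)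
  qed
  then have "((\<lambda>y. \<chi> i. partial_deriv i f y) has_derivative (\<lambda>h. \<chi> i. (hessian f x *v h) $ i)) (at x)"
    by (subst has_derivative_componentwise_within) 
       (auto simp: Basis_vec_def inner_axis)
  then show ?thesis by (simp add: gradient_def[abs_def])
qed

lemma has_real_derivative_gradient_along_curve:
  fixes f :: "real^'n::finite \<Rightarrow> real"
  assumes "open S" "C2_on S f" "\<gamma> t \<in> S" "(\<gamma> has_vector_derivative \<gamma>' t) (at t)"
    "(\<gamma>' has_vector_derivative \<gamma>'') (at t)"
  shows "((\<lambda>t. gradient f (\<gamma> t) \<bullet> \<gamma>' t) has_real_derivative
    (hessian f (\<gamma> t) *v \<gamma>' t) \<bullet> \<gamma>' t + gradient f (\<gamma> t) \<bullet> \<gamma>'') (at t)"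
proof -
  note g = has_derivative_compose[OF assms(4)[unfolded has_vector_derivative_def] gradient_has_derivative[OF assms(1-3)]]
  have eq: "(\<lambda>h. gradient f (\<gamma> t) \<bullet> (h *\<^sub>R \<gamma>'') + (hessian f (\<gamma> t) *v (h *\<^sub>R \<gamma>' t)) \<bullet> \<gamma>' t)
      = (*) ((hessian f (\<gamma> t) *v \<gamma>' t) \<bullet> \<gamma>' t + gradient f (\<gamma> t) \<bullet> \<gamma>'')"
    by (simp add: fun_eq_iff matrix_vector_mult_scaleR algebra_simps)
  show ?thesis
    using has_derivative_inner[OF g assms(5)[unfolded has_vector_derivative_def]]
    unfolding has_field_derivative_def eq .
qed

section \<open>Positive semidefinite matrices\<close>

definition outer_product :: "real^'n \<Rightarrow> real^'n \<Rightarrow> real^'n^'n::finite" where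
  "outer_product x y = (\<chi> i j. x $ i * y $ j)"

lemma outer_product_nth [simp]: "outer_product x y $ i $ j = x $ i * y $ j"
  by (simp add: outer_product_def)

lemma outer_product_self_sym [simp]: "outer_product x x \<in> sym_matrices"
  by (simp add: mem_sym_matrices_iff mult.commute)

lemma outer_product_mult_vec: "outer_product x y *v z = (y \<bullet> z) *\<^sub>R x"
  by (simp add: vec_eq_iff matrix_vector_mult_def inner_vec_def sum_distrib_left sum_distrib_right
      mult_ac)

lemma sym_inner_commute:
  fixes H :: "real^'n^'n::finite"
  assumes "H \<in> sym_matrices"
  shows "x \<bullet> (H *v y) = y \<bullet> (H *v x)"
  using assms by (metis (mono_tags, lifting) dot_lmul_matrix inner_commute mem_Collect_eq sym_matrices_def transpose_matrix_vector)

lemma sym_matrix_mult_axis: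
  assumes "H \<in> sym_matrices"
  shows "H *v axis i 1 = H $ i"
  using assms by (simp add: vec_eq_iff matrix_vector_mul_component inner_axis mem_sym_matrices_iff)

lemma subspace_sym_matrices: "subspace sym_matrices"
  by (auto simp: subspace_def sym_matrices_def transpose_def vec_eq_iff)

lemmas sym_matrices_add = subspace_add[OF subspace_sym_matrices]
  and sym_matrices_diff = subspace_diff[OF subspace_sym_matrices]
  and sym_matrices_scaleR = subspace_scale[OF subspace_sym_matrices]

lemma sym_unit_sym: "sym_unit i j \<in> sym_matrices"
  unfolding mem_sym_matrices_iff by (simp add: sym_unit_def conj_commute add.commute)

text \<open>
  A positive semidefinite matrix is a sum of matrices \<open>\<xi> \<xi>\<^sup>T\<close>, and these are the directions
  that an ellipticity condition speaks about. The proof is Cholesky's elimination: a nonzero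
  row \<open>i\<close> has \<open>H\<^sub>i\<^sub>i > 0\<close>, and subtracting the rank-one matrix built from that row leaves a
  positive semidefinite matrix with strictly fewer nonzero rows.
\<close>

lemma linear_nonneg_on_psd:
  fixes L :: "real^'n^'n::finite \<Rightarrow> real"
  assumes L: "linear L" and rank1: "\<And>\<xi>. 0 \<le> L (outer_product \<xi> \<xi>)"
    and "H \<in> sym_matrices" and "\<And>\<xi>. 0 \<le> \<xi> \<bullet> (H *v \<xi>)"
  shows "0 \<le> L H"
  using assms(3,4)
proof (induction "card {i. H $ i \<noteq> 0}" arbitrary: H rule: less_induct)
  case less
  note sym = less.prems(1) and psd = less.prems(2)
  have symD: "H $ i $ j = H $ j $ i" for i j using sym by (simp add: mem_sym_matrices_iff)
  show ?case
  proof (cases "H = 0")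
    case True
    then show ?thesis using linear_0[OF L] by simp
  next
    case False
    then obtain i where i: "H $ i \<noteq> 0" by (auto simp: vec_eq_iff)
    let ?e = "axis i 1 :: real^'n"
    define d where "d = H $ i $ i"
    have Hi: "\<xi> \<bullet> (H *v ?e) = H $ i \<bullet> \<xi>" for \<xi>
      by (simp add: sym_matrix_mult_axis[OF sym] inner_commute)
    have dd: "?e \<bullet> (H *v ?e) = d"
      by (simp add: sym_matrix_mult_axis[OF sym] d_def inner_axis')
    have expand: "(\<xi> - t *\<^sub>R ?e) \<bullet> (H *v (\<xi> - t *\<^sub>R ?e))
        = \<xi> \<bullet> (H *v \<xi>) - 2 * t * (H $ i \<bullet> \<xi>) + t\<^sup>2 * d" for \<xi> t
      using Hi[of \<xi>] sym_inner_commute[OF sym, of ?e \<xi>] dd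
      by (simp add: matrix_vector_mult_diff_distrib matrix_vector_mult_scaleR inner_diff_left inner_diff_right
          power2_eq_square algebra_simps)
    have "0 \<le> d" using psd[of ?e] dd by simp
    moreover have "d \<noteq> 0"
    proof
      assume "d = 0"
      have "H $ i \<bullet> H $ i > 0" using i by simp
      \<comment> \<open>If \<open>H\<^sub>i\<^sub>i = 0\<close>, the quadratic form is affine along \<open>t \<mapsto> H\<^sub>i - t e\<^sub>i\<close> with slope
        \<open>- 2 |H\<^sub>i|\<^sup>2\<close>, and this \<open>t\<close> makes it negative.\<close>
      define t where "t = (H $ i \<bullet> (H *v (H $ i)) + 1) / (H $ i \<bullet> H $ i)"
      show False
        using psd[of "H $ i - t *\<^sub>R ?e"] psd[of "H $ i"] \<open>d = 0\<close> \<open>H $ i \<bullet> H $ i > 0\<close>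
        unfolding expand by (simp add: t_def)
    qed
    ultimately have d: "0 < d" by simp
    define H' where "H' = H - (1 / d) *\<^sub>R outer_product (H $ i) (H $ i)"
    have H'nth: "H' $ a $ b = H $ a $ b - H $ i $ a * H $ i $ b / d" for a b
      by (simp add: H'_def)
    have "0 \<le> L H'"
    proof (rule less.hyps)
      have "{a. H' $ a \<noteq> 0} \<subseteq> {a. H $ a \<noteq> 0}"
      proof clarify
        fix a assume "H' $ a \<noteq> 0" "H $ a = 0"
        moreover from \<open>H $ a = 0\<close> have "H $ i $ a = 0" using symD[of i a] by simp
        ultimately show False by (simp add: vec_eq_iff H'nth)
      qed
      moreover have "H' $ i = 0"
        using d by (simp add: vec_eq_iff H'nth d_def)
      ultimately show "card {a. H' $ a \<noteq> 0} < card {a. H $ a \<noteq> 0}"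
        using i by (intro psubset_card_mono) auto
      show "H' \<in> sym_matrices"
        unfolding H'_def using sym by (intro sym_matrices_diff sym_matrices_scaleR outer_product_self_sym)
      fix \<xi>
      have "\<xi> \<bullet> (H' *v \<xi>) = \<xi> \<bullet> (H *v \<xi>) - (H $ i \<bullet> \<xi>)\<^sup>2 / d"
        by (simp add: H'_def matrix_vector_mult_diff_rdistrib scaleR_matrix_vector_assoc[symmetric]
            outer_product_mult_vec inner_diff_right power2_eq_square inner_commute)
      \<comment> \<open>Subtracting the rank-one part amounts to minimising the form of \<open>H\<close> along \<open>e\<^sub>i\<close>.\<close>
      also have "\<dots> = (\<xi> - ((H $ i \<bullet> \<xi>) / d) *\<^sub>R ?e) \<bullet> (H *v (\<xi> - ((H $ i \<bullet> \<xi>) / d) *\<^sub>R ?e))"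
        unfolding expand using d by (simp add: power2_eq_square field_simps)
      finally show "0 \<le> \<xi> \<bullet> (H' *v \<xi>)" using psd by simp
    qed
    moreover have "L H = L H' + (1 / d) * L (outer_product (H $ i) (H $ i))"
      by (simp add: H'_def linear_diff[OF L] linear_scale[OF L])
    ultimately show ?thesis using rank1[of "H $ i"] d by simp
  qed
qed

section \<open>Elliptic operators\<close>

type_synonym 'n jet = "real \<times> (real^'n) \<times> (real^'n^'n)"

definition jets :: "('n::finite jet) set" where
  "jets = UNIV \<times> UNIV \<times> sym_matrices"

lemma mem_jets [simp]: "(s, p, N) \<in> jets \<longleftrightarrow> N \<in> sym_matrices"
  by (simp add: jets_def)

text \<open>
  The derivative \<open>F'\<close> is part of the data, since differentiability inside the space of symmetric
  matrices does not determine it on the other matrices. Ellipticity is stated on the matrices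
  \<open>\<xi> \<xi>\<^sup>T\<close>, where \<open>F'\<close> is determined.
\<close>

locale elliptic_operator =
  fixes F :: "'n::finite jet \<Rightarrow> real" and F' :: "'n jet \<Rightarrow> 'n jet \<Rightarrow>\<^sub>L real"
  assumes F_deriv: "P \<in> jets \<Longrightarrow> (F has_derivative F' P) (at P within jets)"
    and F'_cont: "continuous_on jets F'"
    and F'_elliptic: "P \<in> jets \<Longrightarrow> \<xi> \<noteq> 0 \<Longrightarrow> 0 < F' P (0, 0, outer_product \<xi> \<xi>)"

lemma has_real_derivative_along_jet_curve:
  fixes F :: "'n::finite jet \<Rightarrow> real" and F' :: "'n jet \<Rightarrow>\<^sub>L real"
  assumes "(F has_derivative F') (at (\<gamma> t) within jets)" "\<And>t. \<gamma> t \<in> jets"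
    "(\<gamma> has_vector_derivative \<gamma>') (at t)"
  shows "((\<lambda>t. F (\<gamma> t)) has_real_derivative F' \<gamma>') (at t)"
proof -
  have "(F has_derivative F') (at (\<gamma> t) within range \<gamma>)"
    using assms(1,2) by (auto intro: has_derivative_subset)
  from has_derivative_in_compose[OF assms(3)[unfolded has_vector_derivative_def] this]
  show ?thesis
    by (simp add: has_field_derivative_def blinfun.scaleR_right mult_commute_abs)
qed

lemma linear_matrix_part:
  fixes A :: "'n::finite jet \<Rightarrow>\<^sub>L real"
  shows "linear (\<lambda>H. A (0, 0, H))"
  by (rule linearI) (simp_all flip: blinfun.add_right blinfun.scaleR_right real_scaleR_def)

lemma sym_unit_sum_eq_outer_product:
  "(\<Sum>i\<in>UNIV. \<Sum>j\<in>UNIV. (\<xi> $ i * \<xi> $ j) *\<^sub>R sym_unit i j) = outer_product \<xi> \<xi>"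
proof -
  have "(\<Sum>i\<in>UNIV. \<Sum>j\<in>UNIV. (\<xi> $ i * \<xi> $ j) *\<^sub>R sym_unit i j) $ a $ b = \<xi> $ a * \<xi> $ b" for a b
  proof -
    have "(\<Sum>i\<in>UNIV. \<Sum>j\<in>UNIV. (\<xi> $ i * \<xi> $ j) *\<^sub>R sym_unit i j) $ a $ b
      = (\<Sum>i\<in>UNIV. \<Sum>j\<in>UNIV. (if b = j then (if a = i then \<xi> $ i * \<xi> $ j / 2 else 0) else 0))
      + (\<Sum>i\<in>UNIV. \<Sum>j\<in>UNIV. (if a = j then (if b = i then \<xi> $ i * \<xi> $ j / 2 else 0) else 0))"
      unfolding sum.distrib[symmetric] sum_component
      by (intro sum.cong refl) (auto simp: sym_unit_def)
    also have "\<dots> = \<xi> $ a * \<xi> $ b" by simp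
    finally show ?thesis .
  qed
  then show ?thesis by (simp add: vec_eq_iff)
qed

text \<open>
  The coordinate form of ellipticity gives the invariant one, because the symmetrized matrix
  units weighted by \<open>\<xi>\<^sub>i \<xi>\<^sub>j\<close> add up to \<open>\<xi> \<xi>\<^sup>T\<close>.
\<close>

lemma elliptic_operatorI:
  fixes F :: "'n::finite jet \<Rightarrow> real"
  assumes "C1_on (UNIV \<times> UNIV \<times> sym_matrices) F"
    and elliptic: "\<And>s p N \<xi>. N \<in> sym_matrices \<Longrightarrow> \<xi> \<noteq> 0 \<Longrightarrow>
        (\<Sum>i\<in>UNIV. \<Sum>j\<in>UNIV. partial_N F i j (s, p, N) * \<xi> $ i * \<xi> $ j) > 0"
  obtains F' where "elliptic_operator F F'"
proof -
  obtain F' :: "'n jet \<Rightarrow> 'n jet \<Rightarrow>\<^sub>L real"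
    where F': "\<And>P. P \<in> jets \<Longrightarrow> (F has_derivative F' P) (at P within jets)" "continuous_on jets F'"
    using assms(1) unfolding C1_on_def jets_def by blast
  have "0 < F' P (0, 0, outer_product \<xi> \<xi>)" if "P \<in> jets" "\<xi> \<noteq> 0" for P \<xi>
  proof -
    obtain s p N where P: "P = (s, p, N)" by (cases P) auto
    have N: "N \<in> sym_matrices" using that P by simp
    have "partial_N F i j P = F' P (0, 0, sym_unit i j)" for i j
    proof -
      have "((\<lambda>h. F (s, p, N + h *\<^sub>R sym_unit i j)) has_real_derivative F' P (0, 0, sym_unit i j)) (at 0)"
      proof (rule has_real_derivative_along_jet_curve)
        show "(F has_derivative F' P) (at (s, p, N + 0 *\<^sub>R sym_unit i j) within jets)"
          using F'(1)[OF that(1)] P by simp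
        show "((\<lambda>h. (s, p, N + h *\<^sub>R sym_unit i j)) has_vector_derivative (0, 0, sym_unit i j)) (at 0)"
          by (auto intro!: derivative_eq_intros)
        show "(s, p, N + h *\<^sub>R sym_unit i j) \<in> jets" for h
          using N by (simp add: sym_matrices_add sym_matrices_scaleR sym_unit_sym)
      qed
      then show ?thesis by (simp add: partial_N_def P DERIV_imp_deriv)
    qed
    moreover have "F' P (0, 0, outer_product \<xi> \<xi>)
        = (\<Sum>i\<in>UNIV. \<Sum>j\<in>UNIV. (\<xi> $ i * \<xi> $ j) * F' P (0, 0, sym_unit i j))"
      unfolding sym_unit_sum_eq_outer_product[symmetric]
      by (simp add: linear_sum[OF linear_matrix_part] linear_scale[OF linear_matrix_part])
    ultimately show ?thesis
      using elliptic[OF N that(2), of s p] P by (simp add: mult_ac)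
  qed
  then show thesis using F' by (intro that) unfold_locales
qed

context elliptic_operator begin

text \<open>
  Differentiate along the segment from \<open>N\<close> to \<open>N'\<close>: the direction \<open>N' - N\<close> is positive
  semidefinite, hence a sum of the directions in which ellipticity gives a sign.
\<close>

lemma mono_in_matrix:
  assumes N: "N \<in> sym_matrices" "N' \<in> sym_matrices"
    and le: "\<And>\<xi>. \<xi> \<bullet> (N *v \<xi>) \<le> \<xi> \<bullet> (N' *v \<xi>)"
  shows "F (s, p, N) \<le> F (s, p, N')"
proof -
  let ?\<gamma> = "\<lambda>t. (s, p, N + t *\<^sub>R (N' - N))"
  have jets: "?\<gamma> t \<in> jets" for t
    using N by (simp add: sym_matrices_add sym_matrices_diff sym_matrices_scaleR)
  have "F (?\<gamma> 0) \<le> F (?\<gamma> 1)"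
  proof (rule DERIV_nonneg_imp_nondecreasing[where f = "\<lambda>t. F (?\<gamma> t)"])
    fix t :: real
    have "(?\<gamma> has_vector_derivative (0, 0, N' - N)) (at t)"
      by (auto intro!: derivative_eq_intros)
    from has_real_derivative_along_jet_curve[OF F_deriv[OF jets] jets this]
    have "((\<lambda>t. F (?\<gamma> t)) has_real_derivative F' (?\<gamma> t) (0, 0, N' - N)) (at t)" .
    moreover have "0 \<le> F' (?\<gamma> t) (0, 0, N' - N)"
    proof (rule linear_nonneg_on_psd[OF linear_matrix_part])
      show "0 \<le> F' (?\<gamma> t) (0, 0, outer_product \<xi> \<xi>)" for \<xi>
      proof (cases "\<xi> = 0")
        case True
        then have "outer_product \<xi> \<xi> = 0" by (simp add: vec_eq_iff)
        then show ?thesis by (simp add: linear_0[OF linear_matrix_part])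
      next
        case False
        then show ?thesis using F'_elliptic[OF jets] less_imp_le by blast
      qed
      show "N' - N \<in> sym_matrices" using N by (simp add: sym_matrices_diff)
      show "0 \<le> \<xi> \<bullet> ((N' - N) *v \<xi>)" for \<xi>
        using le[of \<xi>] by (simp add: matrix_vector_mult_diff_rdistrib inner_diff_right)
    qed
    ultimately show "\<exists>y. ((\<lambda>t. F (?\<gamma> t)) has_real_derivative y) (at t) \<and> 0 \<le> y" by blast
  qed simp
  then show ?thesis by simp
qed

end

section \<open>The barrier estimate\<close>

lemma continuous_on_outer_product [continuous_intros]:
  "continuous_on S f \<Longrightarrow> continuous_on S g \<Longrightarrow> continuous_on S (\<lambda>x. outer_product (f x) (g x))"
  unfolding outer_product_def by (intro continuous_on_vec_lambda continuous_intros)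

text \<open>
  Let \<open>V x = v (x + \<sigma> x *\<^sub>R e)\<close>, where \<open>e\<close> is the \<open>k\<close>-th unit vector and \<open>\<sigma>\<close> has gradient
  \<open>- \<tau> y\<close> and Hessian \<open>\<tau> (2 \<alpha> y y\<^sup>T - I)\<close> at the point \<open>x\<close>. By the chain rule the two functions
  below are the gradient and the Hessian of \<open>V\<close> at \<open>x\<close> in terms of the gradient \<open>p\<close> and the
  symmetric Hessian \<open>N\<close> of \<open>v\<close> at \<open>x + \<sigma> x *\<^sub>R e\<close>; the row \<open>N $ k\<close> stands for \<open>N e\<close>. The functions \<open>\<sigma>\<close> of interest are
  \<open>\<epsilon> exp (- \<alpha> |x - c|\<^sup>2) + b\<close>, for which \<open>y = x - c\<close> and \<open>\<tau> = 2 \<alpha> \<epsilon> exp (- \<alpha> |y|\<^sup>2)\<close>.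
\<close>

definition bent_gradient :: "'n::finite \<Rightarrow> real \<Rightarrow> real^'n \<Rightarrow> real^'n \<Rightarrow> real^'n" where
  "bent_gradient k \<tau> y p = p - (\<tau> * p $ k) *\<^sub>R y"

definition bent_hessian ::
    "'n::finite \<Rightarrow> real \<Rightarrow> real \<Rightarrow> real^'n \<Rightarrow> real^'n \<Rightarrow> real^'n^'n \<Rightarrow> real^'n^'n" where
  "bent_hessian k \<alpha> \<tau> y p N = N + \<tau> *\<^sub>R ((2 * \<alpha> * p $ k + \<tau> * N $ k $ k) *\<^sub>R outer_product y y
     - (outer_product (N $ k) y + outer_product y (N $ k)) - p $ k *\<^sub>R mat 1)"

lemma bent_hessian_sym:
  fixes y :: "real^'n::finite"
  assumes "N \<in> sym_matrices"
  shows "bent_hessian k \<alpha> \<tau> y p N \<in> sym_matrices"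
proof -
  have 1: "outer_product (N $ k) y + outer_product y (N $ k) \<in> sym_matrices"
    unfolding mem_sym_matrices_iff by (simp add: mult.commute add.commute)
  have 2: "(mat 1 :: real^'n^'n) \<in> sym_matrices"
    unfolding mem_sym_matrices_iff by (simp add: mat_def)
  show ?thesis
    unfolding bent_hessian_def
    by (intro sym_matrices_add[OF assms] sym_matrices_diff sym_matrices_scaleR 1 2 outer_product_self_sym)
qed

context elliptic_operator begin

text \<open>
  At \<open>\<tau> = 0\<close> the derivative of the right-hand side in \<open>\<tau>\<close> is \<open>R + \<alpha> Q\<close>,
  where \<open>Q\<close> is \<open>2 p\<^sub>k\<close> times the derivative of \<open>F\<close> in the direction \<open>y y\<^sup>T\<close>, hence positive, and
  \<open>R\<close> does not depend on \<open>\<alpha>\<close>. A large \<open>\<alpha>\<close> makes this derivative positive on all of \<open>K\<close>, and by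
  compactness it stays positive for small \<open>\<tau>\<close>.
\<close>

lemma bending_increases:
  fixes K :: "('n jet \<times> (real^'n)) set" and k :: 'n
  assumes K: "compact K"
    and Kpos: "\<And>s p N y. ((s, p, N), y) \<in> K \<Longrightarrow> N \<in> sym_matrices \<and> 0 < p $ k \<and> y \<noteq> 0"
  obtains \<alpha> \<tau>0 where "0 < \<alpha>" "0 < \<tau>0"
    "\<And>\<tau> s p N y. 0 < \<tau> \<Longrightarrow> \<tau> \<le> \<tau>0 \<Longrightarrow> ((s, p, N), y) \<in> K \<Longrightarrow>
       F (s, p, N) < F (s, bent_gradient k \<tau> y p, bent_hessian k \<alpha> \<tau> y p N)"
proof (cases "K = {}")
  case True
  then show thesis using that[of 1 1] by simp
next
  case False
  let ?p = "\<lambda>z :: 'n jet \<times> (real^'n). fst (snd (fst z))"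
  let ?N = "\<lambda>z :: 'n jet \<times> (real^'n). snd (snd (fst z))"
  define B where "B z = outer_product (?N z $ k) (snd z) + outer_product (snd z) (?N z $ k)" for z
  define R where "R z = F' (fst z) (0, - (?p z $ k) *\<^sub>R snd z, - B z - ?p z $ k *\<^sub>R mat 1)" for z
  define Q where "Q z = 2 * ?p z $ k * F' (fst z) (0, 0, outer_product (snd z) (snd z))" for z
  have Kjets: "fst z \<in> jets" "0 < ?p z $ k" "snd z \<noteq> 0" if "z \<in> K" for z
    using that Kpos by (cases z; force)+
  have cF': "continuous_on K (\<lambda>z. F' (fst z))"
    using Kjets by (intro continuous_on_compose2[OF F'_cont] continuous_intros) auto
  have cR: "continuous_on K R" and cQ: "continuous_on K Q"
    unfolding R_def Q_def B_def by (intro continuous_intros cF')+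
  obtain zQ where zQ: "zQ \<in> K" "\<And>z. z \<in> K \<Longrightarrow> Q zQ \<le> Q z"
    using continuous_attains_inf[OF K False cQ] by blast
  obtain zR where zR: "zR \<in> K" "\<And>z. z \<in> K \<Longrightarrow> R zR \<le> R z"
    using continuous_attains_inf[OF K False cR] by blast
  have Q0: "0 < Q zQ"
    unfolding Q_def using Kjets[OF zQ(1)] F'_elliptic by (intro mult_pos_pos) auto
  define \<alpha> where "\<alpha> = (\<bar>R zR\<bar> + 1) / Q zQ"
  have "0 < \<alpha>" using Q0 by (simp add: \<alpha>_def)
  have RQ: "0 < R z + \<alpha> * Q z" if "z \<in> K" for z
  proof -
    have "\<bar>R zR\<bar> + 1 = \<alpha> * Q zQ" using Q0 by (simp add: \<alpha>_def)
    also have "\<dots> \<le> \<alpha> * Q z" using zQ(2)[OF that] \<open>0 < \<alpha>\<close> by simp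
    finally show ?thesis using zR(2)[OF that] by linarith
  qed
  define \<gamma> where "\<gamma> \<tau> z = (fst (fst z), bent_gradient k \<tau> (snd z) (?p z), bent_hessian k \<alpha> \<tau> (snd z) (?p z) (?N z))"
    for \<tau> z
  define \<gamma>' where "\<gamma>' \<tau> z = (0 :: real, - (?p z $ k) *\<^sub>R snd z,
      (2 * \<alpha> * ?p z $ k + 2 * \<tau> * ?N z $ k $ k) *\<^sub>R outer_product (snd z) (snd z) - B z - ?p z $ k *\<^sub>R mat 1)"
    for \<tau> z
  have \<gamma>jets: "\<gamma> \<tau> z \<in> jets" if "z \<in> K" for \<tau> z
    using Kjets(1)[OF that] by (cases z) (auto simp: \<gamma>_def intro: bent_hessian_sym)
  have deriv: "((\<lambda>\<tau>. \<gamma> \<tau> z) has_vector_derivative \<gamma>' \<tau> z) (at \<tau>)" for \<tau> z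
    unfolding \<gamma>_def \<gamma>'_def bent_gradient_def bent_hessian_def B_def[symmetric]
    by (auto intro!: derivative_eq_intros simp: algebra_simps)
  define g where "g = (\<lambda>(\<tau>, z). F' (\<gamma> \<tau> z) (\<gamma>' \<tau> z))"
  have "continuous_on ({0..1} \<times> K) g"
  proof -
    have "continuous_on ({0..1} \<times> K) (\<lambda>w. F' (\<gamma> (fst w) (snd w)))"
      using \<gamma>jets
      by (intro continuous_on_compose2[OF F'_cont]) 
         (auto simp: \<gamma>_def bent_gradient_def bent_hessian_def intro!: continuous_intros)
    then show ?thesis
      unfolding g_def \<gamma>'_def B_def case_prod_unfold by (intro continuous_intros)
  qed
  moreover have "0 < g (0, z)" if "z \<in> K" for z
  proof -
    have "\<gamma> 0 z = fst z" by (simp add: \<gamma>_def bent_gradient_def bent_hessian_def)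
    moreover have "\<gamma>' 0 z = (0, - (?p z $ k) *\<^sub>R snd z, - B z - ?p z $ k *\<^sub>R mat 1)
        + (\<alpha> * (2 * ?p z $ k)) *\<^sub>R (0, 0, outer_product (snd z) (snd z))"
      by (simp add: \<gamma>'_def)
    ultimately have "g (0, z) = R z + \<alpha> * Q z"
      unfolding g_def R_def Q_def by (simp only: case_prod_conv blinfun.add_right blinfun.scaleR_right) simp
    then show ?thesis using RQ[OF that] by simp
  qed
  ultimately obtain \<tau>0 where \<tau>0: "0 < \<tau>0" "\<tau>0 \<le> 1"
      "\<And>\<tau> z. 0 \<le> \<tau> \<Longrightarrow> \<tau> \<le> \<tau>0 \<Longrightarrow> z \<in> K \<Longrightarrow> 0 < g (\<tau>, z)"
    using compact_uniform_pos[OF K] by blast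
  show thesis
  proof (rule that[OF \<open>0 < \<alpha>\<close> \<tau>0(1)])
    fix \<tau> s p N y assume \<tau>: "0 < \<tau>" "\<tau> \<le> \<tau>0" and z: "((s, p, N), y) \<in> K"
    let ?z = "((s, p, N), y)"
    have "F (\<gamma> 0 ?z) < F (\<gamma> \<tau> ?z)"
    proof (rule DERIV_pos_imp_increasing[OF \<tau>(1), where f = "\<lambda>t. F (\<gamma> t ?z)"])
      fix t assume "0 \<le> t" "t \<le> \<tau>"
      then have "0 < F' (\<gamma> t ?z) (\<gamma>' t ?z)"
        using \<tau>0(3)[of t, OF _ _ z] \<tau> by (simp add: g_def)
      then show "\<exists>y. ((\<lambda>t. F (\<gamma> t ?z)) has_real_derivative y) (at t) \<and> 0 < y"
        using has_real_derivative_along_jet_curve[OF F_deriv[OF \<gamma>jets[OF z]] \<gamma>jets[OF z] deriv] by blast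
    qed
    then show "F (s, p, N) < F (s, bent_gradient k \<tau> y p, bent_hessian k \<alpha> \<tau> y p N)"
      by (simp add: \<gamma>_def bent_gradient_def bent_hessian_def)
  qed
qed

end

text \<open>
  The difference between \<open>u\<close> and the displaced function \<open>x \<mapsto> v (x + h x *\<^sub>R axis k 1)\<close> is minimal at
  \<open>x1\<close>. The first and second derivative tests on the lines through \<open>x1\<close> give both claims, and on a
  line the displaced function is \<open>v\<close> along a plane curve.
\<close>

lemma touching_from_below:
  fixes u v :: "real^'n::finite \<Rightarrow> real" and k :: 'n
  assumes S: "open S" and u: "C2_on S u" and v: "C2_on S v"
    and h: "\<And>x. h x = \<epsilon> * exp (- \<alpha> * ((x - c) \<bullet> (x - c))) + b"
    and x1: "x1 \<in> S" and z1: "z1 \<in> S" "z1 = x1 + h x1 *\<^sub>R axis k 1"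
    and eq: "u x1 = v z1" and r: "0 < r"
    and below: "\<And>x. x \<in> ball x1 r \<Longrightarrow> v (x + h x *\<^sub>R axis k 1) \<le> u x"
    and y: "y = x1 - c" and \<tau>: "\<tau> = 2 * \<alpha> * \<epsilon> * exp (- \<alpha> * (y \<bullet> y))"
  shows "gradient u x1 = bent_gradient k \<tau> y (gradient v z1)"
    and "\<xi> \<bullet> (bent_hessian k \<alpha> \<tau> y (gradient v z1) (hessian v z1) *v \<xi>) \<le> \<xi> \<bullet> (hessian u x1 *v \<xi>)"
proof -
  define e where "e = (axis k 1 :: real^'n)"
  define p where "p = gradient v z1"
  define N where "N = hessian v z1"
  have N: "N \<in> sym_matrices" unfolding N_def by (rule hessian_symmetric[OF S v z1(1)])
  have pe: "p \<bullet> e = p $ k" by (simp add: e_def inner_axis)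
  have Ne: "N *v e = N $ k" unfolding e_def by (rule sym_matrix_mult_axis[OF N])
  have line: "gradient u x1 \<bullet> \<xi> = p \<bullet> \<xi> - \<tau> * p $ k * (y \<bullet> \<xi>) \<and>
     \<xi> \<bullet> (N *v \<xi>) + \<tau> * ((2 * \<alpha> * p $ k + \<tau> * N $ k $ k) * (y \<bullet> \<xi>)\<^sup>2 - 2 * (N $ k \<bullet> \<xi>) * (y \<bullet> \<xi>) - p $ k * (\<xi> \<bullet> \<xi>))
       \<le> \<xi> \<bullet> (hessian u x1 *v \<xi>)" for \<xi>
  proof -
    define E where "E t = \<epsilon> * exp (- \<alpha> * ((y + t *\<^sub>R \<xi>) \<bullet> (y + t *\<^sub>R \<xi>)))" for t
    define \<sigma> where "\<sigma> t = E t + b" for t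
    define \<sigma>' where "\<sigma>' t = - 2 * \<alpha> * (y \<bullet> \<xi> + t * (\<xi> \<bullet> \<xi>)) * E t" for t
    have E': "(E has_real_derivative \<sigma>' t) (at t)" for t
      unfolding E_def \<sigma>'_def
      by (auto intro!: derivative_eq_intros simp: inner_commute algebra_simps)
    have \<sigma>1: "(\<sigma> has_real_derivative \<sigma>' t) (at t)" for t
      unfolding \<sigma>_def using E'[of t] by (auto intro!: derivative_eq_intros)
    have \<tau>E: "\<tau> = 2 * \<alpha> * E 0" by (simp add: \<tau> E_def)
    have \<sigma>2: "(\<sigma>' has_real_derivative \<tau> * (2 * \<alpha> * (y \<bullet> \<xi>)\<^sup>2 - \<xi> \<bullet> \<xi>)) (at 0)"
      unfolding \<sigma>'_def
      by (auto intro!: derivative_eq_intros E' simp: \<sigma>'_def \<tau>E power2_eq_square algebra_simps)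
    have \<sigma>'0: "\<sigma>' 0 = - \<tau> * (y \<bullet> \<xi>)" by (simp add: \<sigma>'_def \<tau>E)
    have \<sigma>h: "\<sigma> t = h (x1 + t *\<^sub>R \<xi>)" for t
      by (simp add: \<sigma>_def E_def h y algebra_simps)
    define \<delta> where "\<delta> t = x1 + t *\<^sub>R \<xi>" for t
    define \<gamma> where "\<gamma> t = x1 + t *\<^sub>R \<xi> + \<sigma> t *\<^sub>R e" for t
    define \<gamma>' where "\<gamma>' t = \<xi> + \<sigma>' t *\<^sub>R e" for t
    have \<delta>d: "(\<delta> has_vector_derivative \<xi>) (at t)" for t
      unfolding \<delta>_def by (auto intro!: derivative_eq_intros)
    have \<gamma>d: "(\<gamma> has_vector_derivative \<gamma>' t) (at t)" for t
      unfolding \<gamma>_def \<gamma>'_def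
      by (auto intro!: derivative_eq_intros \<sigma>1 simp: has_real_derivative_iff_has_vector_derivative[symmetric])
    have \<gamma>dd: "(\<gamma>' has_vector_derivative (\<tau> * (2 * \<alpha> * (y \<bullet> \<xi>)\<^sup>2 - \<xi> \<bullet> \<xi>)) *\<^sub>R e) (at 0)"
      unfolding \<gamma>'_def
      by (auto intro!: derivative_eq_intros \<sigma>2 simp: has_real_derivative_iff_has_vector_derivative[symmetric])
    have 0: "\<delta> 0 = x1" "\<gamma> 0 = z1"
      by (simp_all add: \<delta>_def \<gamma>_def z1(2) \<sigma>h e_def)
    have "isCont \<delta> 0" "isCont \<gamma> 0"
      using \<delta>d \<gamma>d by (auto intro: has_vector_derivative_continuous)
    then have "\<forall>\<^sub>F t in at 0. \<delta> t \<in> S \<inter> ball x1 r" "\<forall>\<^sub>F t in at 0. \<gamma> t \<in> S"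
      unfolding isCont_def 0
      using topological_tendstoD[of \<delta> x1 _ "S \<inter> ball x1 r"] topological_tendstoD[of \<gamma> z1 _ S]
        S x1 z1(1) r by auto
    then have "\<forall>\<^sub>F t in at 0. \<delta> t \<in> S \<inter> ball x1 r \<and> \<gamma> t \<in> S"
      by (rule eventually_conj)
    then obtain \<rho> where \<rho>: "0 < \<rho>" "\<And>t. t \<noteq> 0 \<Longrightarrow> \<bar>t\<bar> < \<rho> \<Longrightarrow> \<delta> t \<in> S \<inter> ball x1 r \<and> \<gamma> t \<in> S"
      by (auto simp: eventually_at dist_real_def)
    have near: "\<delta> t \<in> S" "\<delta> t \<in> ball x1 r" "\<gamma> t \<in> S" if "\<bar>t\<bar> < \<rho>" for t
      using \<rho>(2)[of t] that x1 z1(1) r 0 by (cases "t = 0"; auto)+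
    have C1: "C1_on S u" "C1_on S v" using u v by (auto simp: C2_on_def)
    define \<phi> where "\<phi> t = u (\<delta> t) - v (\<gamma> t)" for t
    define \<phi>' where "\<phi>' t = gradient u (\<delta> t) \<bullet> \<xi> - gradient v (\<gamma> t) \<bullet> \<gamma>' t" for t
    have d1: "(\<phi> has_real_derivative \<phi>' t) (at t)" if "\<bar>t\<bar> < \<rho>" for t
      unfolding \<phi>_def \<phi>'_def
      by (intro DERIV_diff has_real_derivative_along_curve[OF S] C1 near[OF that] \<delta>d \<gamma>d)
    have d2: "(\<phi>' has_real_derivative
        ((hessian u (\<delta> 0) *v \<xi>) \<bullet> \<xi> + gradient u (\<delta> 0) \<bullet> 0) -
        ((hessian v (\<gamma> 0) *v \<gamma>' 0) \<bullet> \<gamma>' 0 + gradient v (\<gamma> 0) \<bullet> ((\<tau> * (2 * \<alpha> * (y \<bullet> \<xi>)\<^sup>2 - \<xi> \<bullet> \<xi>)) *\<^sub>R e))) (at 0)"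
      unfolding \<phi>'_def using near[of 0] \<rho>(1)
      by (intro DERIV_diff has_real_derivative_gradient_along_curve[OF S] u v \<delta>d \<gamma>d \<gamma>dd) auto
    have min: "\<phi> 0 \<le> \<phi> t" if "\<bar>t\<bar> < \<rho>" for t
      using below[OF near(2)[OF that]] eq 0 by (simp add: \<phi>_def) (simp add: \<gamma>_def \<sigma>h \<delta>_def e_def)
    note second = second_derivative_nonneg_at_min[OF \<rho>(1) d1 d2 min]
    have "gradient u x1 \<bullet> \<xi> = p \<bullet> \<xi> - \<tau> * p $ k * (y \<bullet> \<xi>)"
      using second(1) pe by (simp add: \<phi>'_def \<gamma>'_def 0 \<sigma>'0 inner_add_right inner_diff_right algebra_simps flip: p_def)
    moreover have "N *v \<gamma>' 0 = N *v \<xi> - (\<tau> * (y \<bullet> \<xi>)) *\<^sub>R (N $ k)"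
      by (simp add: \<gamma>'_def \<sigma>'0 Ne matrix_vector_mult_diff_distrib matrix_vector_mult_scaleR)
    moreover have "e \<bullet> (N *v \<xi>) = N $ k \<bullet> \<xi>"
      using sym_inner_commute[OF N, of e \<xi>] Ne by (simp add: inner_commute)
    moreover have "N $ k \<bullet> e = N $ k $ k" by (simp add: e_def inner_axis)
    ultimately show ?thesis
      using second(2) pe Ne
      by (simp add: 0 \<gamma>'_def \<sigma>'0 inner_diff_left inner_diff_right inner_commute power2_eq_square
          algebra_simps flip: p_def N_def)
  qed
  show "gradient u x1 = bent_gradient k \<tau> y (gradient v z1)"
  proof -
    have "gradient u x1 \<bullet> \<xi> = bent_gradient k \<tau> y p \<bullet> \<xi>" for \<xi>
      using line by (simp add: bent_gradient_def inner_diff_left)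
    then show ?thesis using vector_eq_rdot p_def by blast
  qed
  show "\<xi> \<bullet> (bent_hessian k \<alpha> \<tau> y (gradient v z1) (hessian v z1) *v \<xi>) \<le> \<xi> \<bullet> (hessian u x1 *v \<xi>)"
  proof -
    have "\<xi> \<bullet> (bent_hessian k \<alpha> \<tau> y p N *v \<xi>) = \<xi> \<bullet> (N *v \<xi>) + \<tau> * ((2 * \<alpha> * p $ k + \<tau> * N $ k $ k) * (y \<bullet> \<xi>)\<^sup>2 - 2 * (N $ k \<bullet> \<xi>) * (y \<bullet> \<xi>) - p $ k * (\<xi> \<bullet> \<xi>))"
      by (simp add: bent_hessian_def matrix_vector_mult_add_rdistrib matrix_vector_mult_diff_rdistrib
          scaleR_matrix_vector_assoc[symmetric] outer_product_mult_vec inner_add_right inner_diff_right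
          power2_eq_square inner_commute algebra_simps)
    then show ?thesis using line[of \<xi>] by (simp add: p_def N_def)
  qed
qed

section \<open>Touching balls\<close>

text \<open>
  Choose a point \<open>a\<close> outside \<open>Z\<close> that is closer to \<open>Z\<close> than to the complement of \<open>S\<close>, and a point
  \<open>x0\<close> of \<open>Z\<close> nearest to \<open>a\<close>. The ball around \<open>a\<close> through \<open>x0\<close> may meet \<open>Z\<close> in further
  boundary points; the ball of half the radius, internally tangent to it at \<open>x0\<close>, does not.
\<close>

lemma obtain_touching_ball:
  fixes S Z :: "'a::euclidean_space set"
  assumes S: "open S" "connected S" and Z: "closedin (top_of_set S) Z" "Z \<noteq> {}" "Z \<noteq> S"
  obtains c R x0 where "0 < R" "x0 \<in> Z" "dist c x0 = R" "cball c R \<subseteq> S"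
    "\<And>x. x \<in> cball c R \<Longrightarrow> x \<in> Z \<Longrightarrow> x = x0"
proof -
  have ZS: "Z \<subseteq> S" using Z(1) by (rule closedin_imp_subset)
  have "\<not> openin (top_of_set S) Z" using S(2) Z by (auto simp: connected_clopen)
  then have "\<not> open Z" using S(1) ZS by (simp add: openin_open_eq)
  then obtain b where b: "b \<in> Z" "\<And>e. 0 < e \<Longrightarrow> \<not> ball b e \<subseteq> Z"
    by (auto simp: open_contains_ball)
  obtain r2 where "0 < r2" "cball b r2 \<subseteq> S"
    using S(1) ZS b(1) open_contains_cball by blast
  define r where "r = r2 / 2"
  have r: "0 < r" "cball b (2 * r) \<subseteq> S" using \<open>0 < r2\<close> \<open>cball b r2 \<subseteq> S\<close> by (auto simp: r_def)
  obtain a where a: "dist b a < r" "a \<notin> Z" using b(2)[OF r(1)] by (meson mem_ball subsetI)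
  have ar: "cball a r \<subseteq> S"
  proof -
    have "cball a r \<subseteq> cball b (2 * r)"
      using a(1) by (intro cball_subset_cball_iff[THEN iffD2] disjI1) (simp add: dist_commute)
    then show ?thesis using r(2) by blast
  qed
  obtain C where C: "closed C" "Z = S \<inter> C" using Z(1) by (auto simp: closedin_closed)
  have "closed (C \<inter> cball a r)" using C by auto
  moreover have bC: "b \<in> C \<inter> cball a r" using a b C by (auto simp: dist_commute)
  ultimately obtain x0 where x0: "x0 \<in> C \<inter> cball a r" "\<And>y. y \<in> C \<inter> cball a r \<Longrightarrow> dist a x0 \<le> dist a y"
    by (metis distance_attains_inf empty_iff)
  have x0Z: "x0 \<in> Z" using x0(1) ar C by auto
  have near: "dist a x0 \<le> dist a z" if "z \<in> Z" for z
    using x0(1) x0(2)[of z] that C by (cases "dist a z \<le> r") auto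
  define R where "R = dist a x0 / 2"
  define c where "c = midpoint a x0"
  have R: "0 < R" using a(2) x0Z by (auto simp: R_def)
  have dc: "dist a c = R" "dist c x0 = R" by (simp_all add: c_def R_def dist_midpoint)
  show thesis
  proof (rule that[OF R x0Z dc(2)])
    have "cball c R \<subseteq> cball a r"
    proof
      fix x assume "x \<in> cball c R"
      then have "dist a x \<le> 2 * R" using dist_triangle[of a x c] dc by simp
      then show "x \<in> cball a r" using x0(1) by (simp add: R_def)
    qed
    then show "cball c R \<subseteq> S" using ar by blast
    fix z assume z: "z \<in> cball c R" "z \<in> Z"
    have "2 * R \<le> dist a z" using near[OF z(2)] by (simp add: R_def)
    moreover have "dist a z \<le> dist a c + dist c z" by (rule dist_triangle)
    ultimately have cz: "dist c z = R" "dist a z = dist a c + dist c z" using z(1) dc by auto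
    \<comment> \<open>Equality in the triangle inequality puts \<open>z\<close> on the ray from \<open>a\<close> through \<open>c\<close>.\<close>
    then have "R *\<^sub>R (c - z) = R *\<^sub>R (a - c)"
      using dist_triangle_eq[of a z c] dc by (simp add: dist_norm)
    then have "c - z = a - c" using R by simp
    then have "z = 2 *\<^sub>R c - a" by (simp add: scaleR_2 algebra_simps)
    then show "z = x0" by (simp add: c_def midpoint_def)
  qed
qed

section \<open>The strong maximum principle\<close>

text \<open>
  Let \<open>h\<close> be a small multiple
  of the Hopf barrier, positive inside the ball, zero on its boundary and negative outside, and
  raise \<open>m\<close> from a negative value until the graph of \<open>x \<mapsto> v (x + (h x + m) *\<^sub>R e)\<close> first meets that
  of \<open>u\<close> over a small closed ball around \<open>x0\<close>. This happens for some \<open>m \<le> 0\<close>, because there is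
  contact at \<open>x0\<close> for \<open>m = 0\<close>. Contact cannot take place on the boundary of the small ball: there
  either \<open>u > v\<close> uniformly and the displacement is small, or the displacement is negative and
  \<open>v\<close> is increasing along \<open>e\<close>. So contact is interior, and the barrier estimate is incompatible
  with the comparison hypothesis.
\<close>

lemma (in elliptic_operator) no_first_contact:
  fixes u v :: "real^'n \<Rightarrow> real" and k :: 'n
  assumes S: "open S" and u: "C2_on S u" and v: "C2_on S v"
    and comparison: "\<And>x x'. x \<in> S \<Longrightarrow> x' \<in> S \<Longrightarrow> same_y k x x' \<Longrightarrow> u x = v x' \<Longrightarrow>
        F (u x, gradient u x, hessian u x) \<le> F (v x', gradient v x', hessian v x')"
    and le: "\<And>x. x \<in> S \<Longrightarrow> v x \<le> u x"
    and R: "0 < R" "cball c R \<subseteq> S" and x0: "dist c x0 = R" "u x0 = v x0"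
    and less: "\<And>x. x \<in> cball c R \<Longrightarrow> x \<noteq> x0 \<Longrightarrow> v x < u x"
    and v_pos: "0 < gradient v x0 $ k"
  shows False
proof -
  define e where "e = (axis k 1 :: real^'n)"
  have ne: "norm e = 1" by (simp add: e_def)
  have C1: "C1_on S u" "C1_on S v" using u v by (auto simp: C2_on_def)
  note cont = C1_on_open(4)[OF S C1(1)] C1_on_open(4)[OF S C1(2)] C1_on_open(3)[OF S C1(2)]
    C2_on_continuous_hessian[OF S v]
  have "x0 \<in> S" using R x0 by auto
  have "open (S \<inter> (\<lambda>z. gradient v z $ k) -` {0<..})"
    by (intro continuous_open_preimage continuous_intros cont S)
  moreover have "x0 \<in> S \<inter> (\<lambda>z. gradient v z $ k) -` {0<..}"
    using \<open>x0 \<in> S\<close> v_pos by simp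
  ultimately obtain r where r: "0 < r" "cball x0 r \<subseteq> S \<inter> (\<lambda>z. gradient v z $ k) -` {0<..}"
    unfolding open_contains_cball by blast
  define \<delta> where "\<delta> = min r R / 2"
  have \<delta>: "0 < \<delta>" "\<delta> < R" "2 * \<delta> \<le> r" using r R by (auto simp: \<delta>_def)
  have big: "z \<in> S" "0 < gradient v z $ k" if "z \<in> cball x0 (2 * \<delta>)" for z
    using that r(2) \<delta>(3) by force+
  have shift: "x + t *\<^sub>R e \<in> cball x0 (2 * \<delta>)" if "x \<in> cball x0 \<delta>" "\<bar>t\<bar> \<le> \<delta>" for x t
    using dist_triangle[of x0 "x + t *\<^sub>R e" x] that by (simp add: dist_norm ne)
  have v_mono: "v (x + s *\<^sub>R e) < v (x + t *\<^sub>R e)"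
    if x: "x \<in> cball x0 \<delta>" and st: "- \<delta> \<le> s" "s < t" "t \<le> \<delta>" for x s t
  proof (rule DERIV_pos_imp_increasing[OF st(2), where f = "\<lambda>t. v (x + t *\<^sub>R e)"])
    fix a assume "s \<le> a" "a \<le> t"
    then have in_big: "x + a *\<^sub>R e \<in> cball x0 (2 * \<delta>)" using st by (intro shift x) auto
    have "((\<lambda>t. x + t *\<^sub>R e) has_vector_derivative e) (at a)"
      by (auto intro!: derivative_eq_intros)
    from has_real_derivative_along_curve[OF S C1(2) big(1)[OF in_big] this] big(2)[OF in_big]
    show "\<exists>y. ((\<lambda>t. v (x + t *\<^sub>R e)) has_real_derivative y) (at a) \<and> 0 < y"
      by (auto simp: e_def inner_axis)
  qed
  have DS: "cball x0 \<delta> \<subseteq> S" using big(1) \<delta>(1) by force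
  have down: "v (x + s *\<^sub>R e) < u x" if "x \<in> cball x0 \<delta>" "- \<delta> \<le> s" "s < 0" for x s
    using v_mono[of x s 0] le[of x] DS that \<delta>(1) by fastforce

  \<comment> \<open>All jets of \<open>v\<close> and all vectors \<open>y = x - c\<close> that can occur at a contact point; as
    \<open>\<delta> < R\<close>, these vectors do not vanish.\<close>
  define K where "K = (\<lambda>(z, y). ((v z, gradient v z, hessian v z), y)) ` (cball x0 (2 * \<delta>) \<times> cball (x0 - c) \<delta>)"
  have "compact K"
    unfolding K_def case_prod_unfold using big(1)
    by (intro compact_continuous_image compact_Times continuous_intros
        continuous_on_compose2[OF cont(2)] continuous_on_compose2[OF cont(3)] continuous_on_compose2[OF cont(4)]) auto
  moreover have "N \<in> sym_matrices \<and> 0 < p $ k \<and> y \<noteq> 0" if "((s, p, N), y) \<in> K" for s p N y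
    using that big \<delta>(2) x0(1) hessian_symmetric[OF S v] by (auto simp: K_def dist_norm norm_minus_commute)
  ultimately obtain \<alpha> \<tau>0 where \<alpha>: "0 < \<alpha>" and \<tau>0: "0 < \<tau>0"
    and bend: "\<And>\<tau> s p N y. 0 < \<tau> \<Longrightarrow> \<tau> \<le> \<tau>0 \<Longrightarrow> ((s, p, N), y) \<in> K \<Longrightarrow>
       F (s, p, N) < F (s, bent_gradient k \<tau> y p, bent_hessian k \<alpha> \<tau> y p N)"
    by (rule bending_increases) blast+

  \<comment> \<open>The part of the boundary of the small ball where the displacement may be positive.\<close>
  define C where "C = sphere x0 \<delta> \<inter> cball c R"
  have C: "compact C" "C \<subseteq> cball x0 \<delta>" "\<And>x. x \<in> C \<Longrightarrow> v x < u x"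
    using less \<delta>(1) by (auto simp: C_def)
  obtain t0 where t0: "0 < t0" "t0 \<le> 1"
    "\<And>t x. 0 \<le> t \<Longrightarrow> t \<le> t0 \<Longrightarrow> x \<in> C \<Longrightarrow> 0 < (\<lambda>(t, x). u x - v (x + (t * \<delta>) *\<^sub>R e)) (t, x)"
  proof (rule compact_uniform_pos[OF C(1)])
    have "(fst w * \<delta>) \<le> \<delta>" if "w \<in> {0..1} \<times> C" for w
      using that \<delta>(1) by (auto simp: mult_left_le_one_le)
    then have "snd w + (fst w * \<delta>) *\<^sub>R e \<in> S" if "w \<in> {0..1} \<times> C" for w
      using that C(2) \<delta>(1) by (intro big(1) shift) auto
    then show "continuous_on ({0..1} \<times> C) (\<lambda>(t, x). u x - v (x + (t * \<delta>) *\<^sub>R e))"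
      unfolding case_prod_unfold using C(2) DS
      by (intro continuous_intros continuous_on_compose2[OF cont(1)] continuous_on_compose2[OF cont(2)]) auto
    show "0 < (\<lambda>(t, x). u x - v (x + (t * \<delta>) *\<^sub>R e)) (0, x)" if "x \<in> C" for x
      using C(3)[OF that] by simp
  qed blast
  \<comment> \<open>The bounds keep displacements harmless on \<open>C\<close>, keep displaced points in the ball of radius
    \<open>2 \<delta>\<close>, and keep the bending parameter \<open>\<tau>\<close> below \<open>\<tau>0\<close>.\<close>
  define \<epsilon> where "\<epsilon> = min (t0 * \<delta>) (min (\<delta> / 4) (\<tau>0 / (2 * \<alpha>)))"
  have "\<epsilon> \<le> \<tau>0 / (2 * \<alpha>)" unfolding \<epsilon>_def by linarith
  moreover have "\<tau>0 / (2 * \<alpha>) * (2 * \<alpha>) = \<tau>0" using \<alpha> by simp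
  ultimately have "\<epsilon> * (2 * \<alpha>) \<le> \<tau>0" using \<alpha> by (metis mult_right_mono less_imp_le mult_pos_pos zero_less_numeral)
  then have \<epsilon>: "0 < \<epsilon>" "\<epsilon> \<le> t0 * \<delta>" "\<epsilon> \<le> \<delta> / 4" "2 * \<alpha> * \<epsilon> \<le> \<tau>0"
    using t0(1) \<delta>(1) \<alpha> \<tau>0 by (simp_all add: \<epsilon>_def mult_ac)
  have edge: "v (x + s *\<^sub>R e) < u x" if "x \<in> C" "- \<delta> \<le> s" "s \<le> \<epsilon>" for x s
  proof (cases "s < 0")
    case True
    then show ?thesis using down that C(2) by blast
  next
    case False
    then have "0 \<le> s / \<delta>" "s / \<delta> \<le> t0" using that \<epsilon>(2) \<delta>(1) by (auto simp: field_simps)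
    then show ?thesis using t0(3)[of "s / \<delta>" x] that(1) \<delta>(1) by simp
  qed
  define h where "h x = \<epsilon> * exp (- \<alpha> * ((x - c) \<bullet> (x - c))) - \<epsilon> * exp (- \<alpha> * R\<^sup>2)" for x
  have norm2: "(x - c) \<bullet> (x - c) = (dist c x)\<^sup>2" for x
    by (metis dist_commute dist_norm power2_norm_eq_inner)
  have h_bound: "\<bar>h x\<bar> \<le> \<epsilon>" for x
  proof -
    have "0 \<le> \<epsilon> * exp (- \<alpha> * a)" "\<epsilon> * exp (- \<alpha> * a) \<le> \<epsilon>" if "0 \<le> a" for a
      using that \<alpha> \<epsilon>(1) by (auto intro!: mult_left_le)
    from this[OF inner_ge_zero[of "x - c"]] this[OF zero_le_power2[of R]] show ?thesis
      unfolding h_def by linarith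
  qed
  have h_neg: "h x < 0" if "x \<notin> cball c R" for x
  proof -
    have "R\<^sup>2 < (dist c x)\<^sup>2" using that R(1) by (intro power_strict_mono) auto
    then show ?thesis unfolding h_def norm2 using \<epsilon>(1) \<alpha> by simp
  qed
  have h0: "h x0 = 0" unfolding h_def norm2 using x0(1) by simp
  have h_cont: "continuous_on A h" for A
    unfolding h_def[abs_def] by (intro continuous_intros)

  \<comment> \<open>The lower end \<open>- \<delta> / 2\<close> exceeds \<open>\<epsilon>\<close> in absolute value, so that all displacements there
    are negative.\<close>
  define M where "M = {- \<delta> / 2..0}"
  define D where "D = cball x0 \<delta>"
  define \<Phi> where "\<Phi> = (\<lambda>(m, x). u x - v (x + (h x + m) *\<^sub>R e))"
  have hm: "\<bar>h x + m\<bar> \<le> \<delta>" if "m \<in> M" for x m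
  proof -
    have "- \<delta> / 2 \<le> m" "m \<le> 0" using that by (auto simp: M_def)
    then show ?thesis using h_bound[of x] \<epsilon>(3) \<delta>(1) by linarith
  qed
  have in_big: "x + (h x + m) *\<^sub>R e \<in> cball x0 (2 * \<delta>)" if "m \<in> M" "x \<in> D" for x m
    using shift hm that by (simp add: D_def)
  have \<Phi>_cont: "continuous_on (M \<times> D) \<Phi>"
    unfolding \<Phi>_def case_prod_unfold using DS in_big big(1)
    by (intro continuous_intros continuous_on_compose2[OF cont(1)] continuous_on_compose2[OF cont(2)]
        continuous_on_compose2[OF h_cont[of UNIV]]) (auto simp: D_def)
  define T where "T = {w \<in> M \<times> D. \<Phi> w \<le> 0}"
  have MD: "compact (M \<times> D)" by (auto simp: M_def D_def intro!: compact_Times)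
  have "compact T" unfolding T_def by (rule compact_nonpos_part[OF MD \<Phi>_cont])
  then have "compact (fst ` T)"
    by (intro compact_continuous_image continuous_intros)
  moreover have "(0, x0) \<in> T"
    using \<delta>(1) h0 x0(2) by (simp add: T_def M_def D_def \<Phi>_def)
  ultimately obtain m1 where m1: "m1 \<in> fst ` T" "\<And>m. m \<in> fst ` T \<Longrightarrow> m1 \<le> m"
    using compact_attains_inf[of "fst ` T"] by blast
  then obtain x1 where x1: "m1 \<in> M" "x1 \<in> D" "\<Phi> (m1, x1) \<le> 0" by (auto simp: T_def)
  have before: "0 \<le> \<Phi> (m, x)" if "m \<in> {- \<delta> / 2..<m1}" "x \<in> D" for m x
  proof (rule ccontr)
    assume "\<not> 0 \<le> \<Phi> (m, x)"
    then have "(m, x) \<in> T" using that x1(1) by (auto simp: T_def M_def)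
    then show False using m1(2)[of m] that by force
  qed
  have m1_gt: "- \<delta> / 2 < m1"
  proof (rule ccontr)
    assume "\<not> - \<delta> / 2 < m1"
    then have "m1 = - \<delta> / 2" using x1(1) by (simp add: M_def)
    then have "h x1 + m1 < 0" using h_bound[of x1] \<epsilon>(3) \<delta>(1) by linarith
    moreover have "- \<delta> \<le> h x1 + m1" using hm[OF x1(1), of x1] by linarith
    ultimately show False using down[of x1 "h x1 + m1"] x1(2,3) by (simp add: D_def \<Phi>_def)
  qed
  have above: "v (x + (h x + m1) *\<^sub>R e) \<le> u x" if "x \<in> D" for x
  proof -
    have "0 \<le> (\<lambda>m. \<Phi> (m, x)) m1"
    proof (rule continuous_ge_on_closure[where S = "{- \<delta> / 2..<m1}" and f = "\<lambda>m. \<Phi> (m, x)"])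
      have cl: "closure {- \<delta> / 2..<m1} = {- \<delta> / 2..m1}" using m1_gt by simp
      show "m1 \<in> closure {- \<delta> / 2..<m1}" using m1_gt unfolding cl by simp
      show "continuous_on (closure {- \<delta> / 2..<m1}) (\<lambda>m. \<Phi> (m, x))"
        unfolding cl using that x1(1)
        by (intro continuous_on_compose2[OF \<Phi>_cont] continuous_intros) (auto simp: M_def)
    qed (use before that in blast)
    then show ?thesis by (simp add: \<Phi>_def)
  qed
  define z1 where "z1 = x1 + (h x1 + m1) *\<^sub>R e"
  have contact: "u x1 = v z1" using above[OF x1(2)] x1(3) by (simp add: \<Phi>_def z1_def)
  have x1S: "x1 \<in> S" using x1(2) DS by (auto simp: D_def)
  have z1: "z1 \<in> cball x0 (2 * \<delta>)" unfolding z1_def by (rule in_big[OF x1(1,2)])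
  have interior: "dist x0 x1 < \<delta>"
  proof (rule ccontr)
    assume "\<not> dist x0 x1 < \<delta>"
    then have sph: "x1 \<in> sphere x0 \<delta>" using x1(2) by (simp add: D_def)
    have s: "- \<delta> \<le> h x1 + m1" "h x1 + m1 \<le> h x1"
      using hm[OF x1(1), of x1] x1(1) by (simp_all add: M_def abs_le_iff)
    have "v z1 < u x1"
    proof (cases "x1 \<in> cball c R")
      case True
      then show ?thesis
        unfolding z1_def using sph s h_bound[of x1] by (intro edge) (auto simp: C_def)
    next
      case False
      then show ?thesis
        unfolding z1_def using h_neg[OF False] s x1(2) by (intro down) (auto simp: D_def)
    qed
    then show False using contact by simp
  qed
  define y where "y = x1 - c"
  define \<tau> where "\<tau> = 2 * \<alpha> * \<epsilon> * exp (- \<alpha> * (y \<bullet> y))"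
  have \<tau>: "0 < \<tau>" "\<tau> \<le> \<tau>0"
  proof -
    show "0 < \<tau>" using \<alpha> \<epsilon>(1) by (simp add: \<tau>_def)
    have "\<tau> \<le> 2 * \<alpha> * \<epsilon>" unfolding \<tau>_def using \<alpha> \<epsilon>(1) by (intro mult_left_le) auto
    then show "\<tau> \<le> \<tau>0" using \<epsilon>(4) by simp
  qed
  have below: "v (x + (h x + m1) *\<^sub>R axis k 1) \<le> u x" if "x \<in> ball x1 (\<delta> - dist x0 x1)" for x
    using above[of x] dist_triangle[of x0 x x1] that by (simp add: D_def e_def)
  have h_eq: "h x + m1 = \<epsilon> * exp (- \<alpha> * ((x - c) \<bullet> (x - c))) + (m1 - \<epsilon> * exp (- \<alpha> * R\<^sup>2))" for x
    by (simp add: h_def)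
  have z1_eq: "z1 = x1 + (h x1 + m1) *\<^sub>R axis k 1" by (simp add: z1_def e_def)
  have "0 < \<delta> - dist x0 x1" using interior by simp
  note touch = touching_from_below[OF S u v h_eq x1S big(1)[OF z1] z1_eq contact this below y_def \<tau>_def]
  have grad_eq: "gradient u x1 = bent_gradient k \<tau> y (gradient v z1)" by (rule touch(1))
  have hess_le: "\<xi> \<bullet> (bent_hessian k \<alpha> \<tau> y (gradient v z1) (hessian v z1) *v \<xi>) \<le> \<xi> \<bullet> (hessian u x1 *v \<xi>)" for \<xi>
    by (rule touch(2))
  have "((v z1, gradient v z1, hessian v z1), y) \<in> K"
    unfolding K_def using z1 x1(2) by (force simp: D_def y_def dist_norm)
  from bend[OF \<tau> this]
  have "F (v z1, gradient v z1, hessian v z1)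
      < F (v z1, gradient u x1, bent_hessian k \<alpha> \<tau> y (gradient v z1) (hessian v z1))"
    unfolding grad_eq .
  also have "\<dots> \<le> F (v z1, gradient u x1, hessian u x1)"
    by (intro hess_le mono_in_matrix bent_hessian_sym hessian_symmetric[OF S] u v x1S big(1)[OF z1])
  also have "\<dots> \<le> F (v z1, gradient v z1, hessian v z1)"
    using comparison[OF x1S big(1)[OF z1] _ contact] contact
    by (simp add: same_y_def z1_eq axis_def)
  finally show False by simp
qed

lemma open_cylinder: "open (cylinder k)"
  unfolding cylinder_def L2_set_def
  by (intro open_Collect_conj open_Collect_less continuous_intros)

lemma convex_cylinder:
  fixes k :: "'n::finite"
  shows "convex (cylinder k)"
proof (rule convexI)
  fix x y :: "real^'n" and a b :: real
  assume xy: "x \<in> cylinder k" "y \<in> cylinder k" and ab: "0 \<le> a" "0 \<le> b" "a + b = 1"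
  have "L2_set (\<lambda>i. (a *\<^sub>R x + b *\<^sub>R y) $ i) (UNIV - {k})
      \<le> L2_set (\<lambda>i. a * x $ i) (UNIV - {k}) + L2_set (\<lambda>i. b * y $ i) (UNIV - {k})"
    by (simp add: L2_set_triangle_ineq)
  also have "\<dots> = a * L2_set (\<lambda>i. x $ i) (UNIV - {k}) + b * L2_set (\<lambda>i. y $ i) (UNIV - {k})"
    using ab by (simp add: L2_set_right_distrib)
  also have "\<dots> < 1"
    using xy ab by (intro convex_bound_lt) (auto simp: cylinder_def)
  finally have 1: "L2_set (\<lambda>i. (a *\<^sub>R x + b *\<^sub>R y) $ i) (UNIV - {k}) < 1" .
  have 2: "a * x $ k + b * y $ k < 1"
    using xy ab by (intro convex_bound_lt) (auto simp: cylinder_def)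
  have 3: "0 < a * x $ k + b * y $ k"
    using convex_bound_lt[of "- x $ k" 0 "- y $ k" a b] xy ab by (simp add: cylinder_def)
  show "a *\<^sub>R x + b *\<^sub>R y \<in> cylinder k"
    unfolding cylinder_def mem_Collect_eq using 2 3 by (intro conjI 1) simp_all
qed

theorem theorem4:
  fixes F :: "real \<times> (real^'n) \<times> (real^'n^'n) \<Rightarrow> real"
    and u v :: "real^'n \<Rightarrow> real"
    and k :: "'n::finite"
  assumes n_ge_2: "CARD('n) \<ge> 2"
    and F_C1: "C1_on (UNIV \<times> UNIV \<times> sym_matrices) F"
    and elliptic: "\<And>s p N \<xi>. N \<in> sym_matrices \<Longrightarrow> \<xi> \<noteq> 0 \<Longrightarrow>
        (\<Sum>i\<in>UNIV. \<Sum>j\<in>UNIV. partial_N F i j (s, p, N) * \<xi> $ i * \<xi> $ j) > 0"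
    and u_C2: "C2_on (cylinder k) u"
    and v_C2: "C2_on (cylinder k) v"
    and a: "\<And>x x'. x \<in> cylinder k \<Longrightarrow> x' \<in> cylinder k \<Longrightarrow> same_y k x x' \<Longrightarrow> u x = v x' \<Longrightarrow>
        F (u x, gradient u x, hessian u x) \<le> F (v x', gradient v x', hessian v x')"
    and b: "\<And>x. x \<in> cylinder k \<Longrightarrow> u x \<ge> v x"
    and c: "\<And>x. x \<in> cylinder k \<Longrightarrow> max (partial_deriv k u x) (partial_deriv k v x) > 0"
  shows "(\<forall>x\<in>cylinder k. u x > v x) \<or> (\<forall>x\<in>cylinder k. u x = v x)"
proof (rule ccontr)
  assume neg: "\<not> ?thesis"
  obtain F' where "elliptic_operator F F'"
    using elliptic_operatorI[OF F_C1 elliptic] .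
  then interpret elliptic_operator F F' .
  let ?S = "cylinder k"
  have C1: "C1_on ?S u" "C1_on ?S v" using u_C2 v_C2 by (auto simp: C2_on_def)
  note D = C1_on_open[OF open_cylinder C1(1)] C1_on_open[OF open_cylinder C1(2)]
  define Z where "Z = {x \<in> ?S. u x = v x}"
  have "closedin (top_of_set ?S) Z"
  proof -
    have "continuous_on ?S (\<lambda>x. u x - v x)" using D by (intro continuous_intros)
    from continuous_closedin_preimage_constant[OF this, of 0]
    show ?thesis by (simp add: Z_def)
  qed
  moreover have "Z \<noteq> {}" "Z \<noteq> ?S"
    using neg b by (force simp: Z_def order_less_le)+
  ultimately obtain p R x0 where p: "0 < R" "x0 \<in> Z" "dist p x0 = R" "cball p R \<subseteq> ?S"
    "\<And>x. x \<in> cball p R \<Longrightarrow> x \<in> Z \<Longrightarrow> x = x0"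
    using obtain_touching_ball[OF open_cylinder convex_connected[OF convex_cylinder]] by metis
  have x0: "x0 \<in> ?S" "u x0 = v x0" using p(2) by (auto simp: Z_def)
  \<comment> \<open>At \<open>x0\<close> the difference \<open>u - v\<close> is minimal, so the two derivatives along the \<open>k\<close>-th axis
    agree and equal their maximum, which is positive.\<close>
  have "((\<lambda>x. u x - v x) has_derivative (\<lambda>h. gradient u x0 \<bullet> h - gradient v x0 \<bullet> h)) (at x0)"
    using D x0(1) by (intro has_derivative_diff) auto
  then have "(\<lambda>h. gradient u x0 \<bullet> h - gradient v x0 \<bullet> h) = (\<lambda>h. 0)"
    using x0 b by (intro differential_zero_maxmin[OF x0(1) open_cylinder]) auto
  then have "gradient u x0 \<bullet> axis k 1 - gradient v x0 \<bullet> axis k 1 = 0"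
    by (rule fun_cong)
  then have "0 < gradient v x0 $ k"
    using c[OF x0(1)] by (simp add: inner_axis gradient_def)
  moreover have "v x < u x" if "x \<in> cball p R" "x \<noteq> x0" for x
    using p(4,5) b[of x] that by (force simp: Z_def order_less_le)
  ultimately show False
    using no_first_contact[OF open_cylinder u_C2 v_C2 a b p(1,4,3) x0(2)] by blast
qed

end
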